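(* Let $p^\star=\sum_{\ell=1}^m\pi_\ell^\star\phi(\cdot\mid\mu_\ell^\star)$ satisfy the standing assumptions (A1)–(A3) of the context. Let $\pi\in\Delta^{n-1}$ have strictly positive entries and let $\widetilde\mu\in\mathbb R^{nd}$ be such that $(\widetilde\mu,\pi)$ induces an exact clustering with partition $[n]=\bigsqcup_{\ell=1}^mS_\ell$, i.e. $\widetilde\mu_i=\mu^\star_\ell$ for all $i\in S_\ell$ and $\sum_{i\in S_\ell}\pi_i=\pi^\star_\ell$ for all $\ell\in[m]$ (so that $(\widetilde\mu,\pi)$ is a global minimizer of $\mathcal L$). Put $f_\pi(\mu):=\mathcal L(\mu,\pi)$. Then there exist a neighborhood $U$ of $\widetilde\mu$ in $\mathbb R^{nd}$ and a constant $c_4>0$ such that $$f_\pi(\mu)-f_\pi(\widetilde\mu)\ \ge\ c_4\,\|\mu-\widetilde\mu\|_2^4\qquad\text{for all }\mu\in U.$$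
   Context: $\phi(x\mid\mu)=(2\pi)^{-d/2}e^{-\|x-\mu\|^2/2}$ on $\mathbb R^d$; $\Delta^{k-1}$ is the probability simplex in $\mathbb R^k$; $[n]=\{1,\dots,n\}$. Teacher weights $\pi^\star\in\Delta^{m-1}$ are positive. For $\mu=(\mu_1,\dots,\mu_n)\in\mathbb R^{nd}$ and $\pi\in\Delta^{n-1}$, $p_{\mu,\pi}=\sum_{i=1}^n\pi_i\phi(\cdot\mid\mu_i)$ and $\mathcal L(\mu,\pi)=\mathbb E_{X\sim p^\star}[\log(p^\star(X)/p_{\mu,\pi}(X))]$. Standing assumptions on the teacher: (A1) $M^\star=\sum_{\ell}\pi^\star_\ell\mu_\ell^\star{\mu_\ell^\star}^{\top}$ has exactly $m$ nonzero eigenvalues, the largest being $\lambda_{\max}$ and the smallest $\lambda_{\min}>0$. (A2) $D_{\max}\ge\|\mu_\ell^\star\|\ge D_{\min}\ge 4\frac{\lambda_{\max}}{\lambda_{\min}}\sqrt{dn}$ for all $\ell$. (A3) With $\pi^\star_{\min}=\min_\ell\pi^\star_\ell$, $\min_{i\ne j}\|\mu_i^\star-\mu_j^\star\|\ge C_0\max\{\sqrt{D_{\max}}(dn)^{1/4},\sqrt{d/\pi^\star_{\min}},\sqrt{\log(D_{\max}dnm/(\lambda_{\min}\pi^\star_{\min}))}\}$ for a sufficiently large absolute constant $C_0>0$. *)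

theory Defs
  imports "HOL-Probability.Probability" "Jordan_Normal_Form.Char_Poly"
begin

text \<open>
  The dimension \<open>d\<close>, the number \<open>m\<close> of teacher components and the number \<open>n\<close> of
  student components are natural numbers, so that a constant can be chosen uniformly in all of them.
  Indices start at 0. A point of \<open>d\<close>-space is a function of type \<^typ>\<open>nat \<Rightarrow> real\<close> of which only
  the values on \<open>{..<d}\<close> are used; a family of \<open>k\<close> points is a function of type
  \<^typ>\<open>nat \<Rightarrow> nat \<Rightarrow> real\<close> of which only the values at \<open>i < k\<close> and \<open>j < d\<close> are used.
\<close>

definition eucl_norm :: "nat \<Rightarrow> (nat \<Rightarrow> real) \<Rightarrow> real" where
  "eucl_norm d x = L2_set x {..<d}"

definition eucl_dist :: "nat \<Rightarrow> (nat \<Rightarrow> real) \<Rightarrow> (nat \<Rightarrow> real) \<Rightarrow> real" where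
  "eucl_dist d x y = eucl_norm d (\<lambda>j. x j - y j)"

definition family_dist :: "nat \<Rightarrow> nat \<Rightarrow> (nat \<Rightarrow> nat \<Rightarrow> real) \<Rightarrow> (nat \<Rightarrow> nat \<Rightarrow> real) \<Rightarrow> real" where
  "family_dist n d \<mu> \<nu> = L2_set (\<lambda>(i, j). \<mu> i j - \<nu> i j) ({..<n} \<times> {..<d})"

definition neighbourhood :: "nat \<Rightarrow> nat \<Rightarrow> (nat \<Rightarrow> nat \<Rightarrow> real) \<Rightarrow> (nat \<Rightarrow> nat \<Rightarrow> real) set \<Rightarrow> bool" where
  "neighbourhood n d \<mu> U \<longleftrightarrow> (\<exists>\<epsilon>>0. \<forall>\<nu>. family_dist n d \<nu> \<mu> < \<epsilon> \<longrightarrow> \<nu> \<in> U)"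

definition prob_simplex :: "nat \<Rightarrow> (nat \<Rightarrow> real) set" where
  "prob_simplex k = {w. (\<forall>i<k. 0 \<le> w i) \<and> (\<Sum>i<k. w i) = 1}"

definition gauss :: "nat \<Rightarrow> (nat \<Rightarrow> real) \<Rightarrow> (nat \<Rightarrow> real) \<Rightarrow> real" where
  "gauss d x \<mu> = (2 * pi) powr (- real d / 2) * exp (- (eucl_dist d x \<mu>)\<^sup>2 / 2)"

definition mixture :: "nat \<Rightarrow> nat \<Rightarrow> (nat \<Rightarrow> nat \<Rightarrow> real) \<Rightarrow> (nat \<Rightarrow> real) \<Rightarrow> (nat \<Rightarrow> real) \<Rightarrow> real" where
  "mixture d k \<mu> w x = (\<Sum>i<k. w i * gauss d x (\<mu> i))"

definition mixture_measure :: "nat \<Rightarrow> nat \<Rightarrow> (nat \<Rightarrow> nat \<Rightarrow> real) \<Rightarrow> (nat \<Rightarrow> real) \<Rightarrow> (nat \<Rightarrow> real) measure" where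
  "mixture_measure d k \<mu> w =
     density (\<Pi>\<^sub>M j\<in>{..<d}. lborel) (\<lambda>x. ennreal (mixture d k \<mu> w x))"

text \<open>The log ratio has at most quadratic growth when \<open>\<pi>\<close> lies in the simplex, hence the
  Bochner integral below is a genuine expectation.\<close>

definition pop_loss :: "nat \<Rightarrow> nat \<Rightarrow> (nat \<Rightarrow> nat \<Rightarrow> real) \<Rightarrow> (nat \<Rightarrow> real) \<Rightarrow>
    nat \<Rightarrow> (nat \<Rightarrow> nat \<Rightarrow> real) \<Rightarrow> (nat \<Rightarrow> real) \<Rightarrow> real" where
  "pop_loss d m \<mu>s \<pi>s n \<mu> \<pi> =
     (\<integral>x. ln (mixture d m \<mu>s \<pi>s x / mixture d n \<mu> \<pi> x) \<partial>mixture_measure d m \<mu>s \<pi>s)"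

definition second_moment :: "nat \<Rightarrow> nat \<Rightarrow> (nat \<Rightarrow> nat \<Rightarrow> real) \<Rightarrow> (nat \<Rightarrow> real) \<Rightarrow> real mat" where
  "second_moment d m \<mu>s \<pi>s = Matrix.mat d d (\<lambda>(i, j). \<Sum>l<m. \<pi>s l * \<mu>s l i * \<mu>s l j)"

definition nonzero_eigenvalues :: "real mat \<Rightarrow> real set" where
  "nonzero_eigenvalues A = {k. eigenvalue A k \<and> k \<noteq> 0}"

text \<open>Eigenvalues are counted with multiplicity. For the symmetric matrices considered here all
  eigenvalues are real, and algebraic and geometric multiplicities agree.\<close>

definition num_nonzero_eigenvalues :: "real mat \<Rightarrow> nat" where
  "num_nonzero_eigenvalues A = (\<Sum>k\<in>nonzero_eigenvalues A. Polynomial.order k (char_poly A))"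

definition lambda_max :: "nat \<Rightarrow> nat \<Rightarrow> (nat \<Rightarrow> nat \<Rightarrow> real) \<Rightarrow> (nat \<Rightarrow> real) \<Rightarrow> real" where
  "lambda_max d m \<mu>s \<pi>s = Max (nonzero_eigenvalues (second_moment d m \<mu>s \<pi>s))"

definition lambda_min :: "nat \<Rightarrow> nat \<Rightarrow> (nat \<Rightarrow> nat \<Rightarrow> real) \<Rightarrow> (nat \<Rightarrow> real) \<Rightarrow> real" where
  "lambda_min d m \<mu>s \<pi>s = Min (nonzero_eigenvalues (second_moment d m \<mu>s \<pi>s))"

definition spectral_cond :: "nat \<Rightarrow> nat \<Rightarrow> (nat \<Rightarrow> nat \<Rightarrow> real) \<Rightarrow> (nat \<Rightarrow> real) \<Rightarrow> bool" where
  "spectral_cond d m \<mu>s \<pi>s \<longleftrightarrow>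
     num_nonzero_eigenvalues (second_moment d m \<mu>s \<pi>s) = m \<and> 0 < lambda_min d m \<mu>s \<pi>s"

definition norm_cond :: "nat \<Rightarrow> nat \<Rightarrow> nat \<Rightarrow> (nat \<Rightarrow> nat \<Rightarrow> real) \<Rightarrow> (nat \<Rightarrow> real) \<Rightarrow>
    real \<Rightarrow> real \<Rightarrow> bool" where
  "norm_cond d m n \<mu>s \<pi>s Dmin Dmax \<longleftrightarrow>
     (\<forall>l<m. Dmin \<le> eucl_norm d (\<mu>s l) \<and> eucl_norm d (\<mu>s l) \<le> Dmax) \<and>
     4 * (lambda_max d m \<mu>s \<pi>s / lambda_min d m \<mu>s \<pi>s) * sqrt (real d * real n) \<le> Dmin"

definition min_weight :: "nat \<Rightarrow> (nat \<Rightarrow> real) \<Rightarrow> real" where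
  "min_weight m \<pi>s = Min (\<pi>s ` {..<m})"

text \<open>The logarithm may be negative. Then \<^const>\<open>sqrt\<close> takes a negative value, so that the third
  term does not contribute to the maximum, the other two being nonnegative. For \<open>m = 1\<close>
  the condition is vacuous.\<close>

definition separation_cond :: "real \<Rightarrow> nat \<Rightarrow> nat \<Rightarrow> nat \<Rightarrow> (nat \<Rightarrow> nat \<Rightarrow> real) \<Rightarrow>
    (nat \<Rightarrow> real) \<Rightarrow> real \<Rightarrow> bool" where
  "separation_cond C d m n \<mu>s \<pi>s Dmax \<longleftrightarrow>
     (\<forall>i<m. \<forall>j<m. i \<noteq> j \<longrightarrow>
        C * Max {sqrt Dmax * (real d * real n) powr (1 / 4),
                 sqrt (real d / min_weight m \<pi>s),
                 sqrt (ln (Dmax * real d * real n * real m /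
                           (lambda_min d m \<mu>s \<pi>s * min_weight m \<pi>s)))}
        \<le> eucl_dist d (\<mu>s i) (\<mu>s j))"

definition exact_clustering :: "nat \<Rightarrow> nat \<Rightarrow> nat \<Rightarrow> (nat \<Rightarrow> nat \<Rightarrow> real) \<Rightarrow> (nat \<Rightarrow> real) \<Rightarrow>
    (nat \<Rightarrow> nat \<Rightarrow> real) \<Rightarrow> (nat \<Rightarrow> real) \<Rightarrow> (nat \<Rightarrow> nat set) \<Rightarrow> bool" where
  "exact_clustering d m n \<mu>s \<pi>s \<mu> \<pi> S \<longleftrightarrow>
     disjoint_family_on S {..<m} \<and> (\<Union>l<m. S l) = {..<n} \<and>
     (\<forall>l<m. (\<forall>i\<in>S l. \<forall>j<d. \<mu> i j = \<mu>s l j) \<and> (\<Sum>i\<in>S l. \<pi> i) = \<pi>s l)"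

end

(* The loss difference is KL(p*||p_mu).  By duality KL(p||q) >= (E_q psi - E_p psi)^2 / (4 B^2) for
   every test function |psi| <= B.  Choose psi such that its Gaussian mean g(a) = E psi(a + Z) is a
   nonnegative trigonometric polynomial with a nondegenerate zero at each of the finitely many
   teacher centres.  Then E_q psi - E_p psi = sum_i pi_i g(mu_i) is bounded below by a multiple of
   the squared distance: its square gives the quartic growth. *)

theory Submission
  imports Defs
begin

section \<open>Gaussian densities: product form, Fourier integrals and quotients\<close>

lemma eucl_dist_sq: "(eucl_dist d x y)\<^sup>2 = (\<Sum>j<d. (x j - y j)\<^sup>2)"
  by (simp add: eucl_dist_def eucl_norm_def L2_set_def sum_nonneg)

lemma gauss_pos: "0 < gauss d x a"
  by (simp add: gauss_def)

lemma gauss_cong: "(\<And>j. j < d \<Longrightarrow> a j = b j) \<Longrightarrow> gauss d x a = gauss d x b"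
  by (simp add: gauss_def eucl_dist_sq)

text \<open>The squared norm is a sum over coordinates, so the exponential factors. This form lets
  integrals over the product measure be computed one coordinate at a time.\<close>

lemma gauss_eq_prod: "gauss d x a = (\<Prod>j<d. normal_density (a j) 1 (x j))"
proof -
  have "(2 * pi) powr (- real d / 2) = (1 / sqrt (2 * pi)) ^ d"
    by (simp add: powr_minus_divide powr_half_sqrt_powr powr_realpow power_divide)
       (metis power_mult_distrib real_sqrt_power)
  moreover have "exp (- (eucl_dist d x a)\<^sup>2 / 2) = (\<Prod>j<d. exp (- (x j - a j)\<^sup>2 / 2))"
    by (simp add: eucl_dist_sq exp_sum[symmetric] sum_negf sum_divide_distrib[symmetric])
  ultimately show ?thesis
    by (simp add: gauss_def normal_density_def prod.distrib prod_dividef power_divide)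
qed

lemma gauss_measurable [measurable]:
  "(\<lambda>x. gauss d x a) \<in> borel_measurable (\<Pi>\<^sub>M j\<in>{..<d}. lborel)"
  unfolding gauss_eq_prod by measurable

interpretation lborel_prod: product_sigma_finite "\<lambda>_::nat. lborel :: real measure"
  by standard

lemma gauss_integrable: "integrable (\<Pi>\<^sub>M j\<in>{..<d}. lborel) (\<lambda>x. gauss d x a)"
  unfolding gauss_eq_prod
  by (rule lborel_prod.product_integrable_prod) auto

lemma gauss_integral: "(\<integral>x. gauss d x a \<partial>(\<Pi>\<^sub>M j\<in>{..<d}. lborel)) = 1"
  unfolding gauss_eq_prod
  by (subst lborel_prod.product_integral_prod) auto

text \<open>The known characteristic function of the standard normal law, translated: substituting
  \<open>a + x\<close> for \<open>x\<close> pulls out the phase \<open>iexp (t * a)\<close>.\<close>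

lemma normal_density_iexp:
  fixes t a :: real
  shows "integrable lborel (\<lambda>x. iexp (t * x) * complex_of_real (normal_density a 1 x))"
    and "(\<integral>x. iexp (t * x) * complex_of_real (normal_density a 1 x) \<partial>lborel)
         = iexp (t * a) * complex_of_real (exp (- t\<^sup>2 / 2))"
proof -
  have "integrable lborel (\<lambda>x. normal_density a 1 x)" by simp
  then have "integrable lborel (\<lambda>x. complex_of_real (normal_density a 1 x))"
    by (rule integrable_of_real)
  then show "integrable lborel (\<lambda>x. iexp (t * x) * complex_of_real (normal_density a 1 x))"
    by (rule Bochner_Integration.integrable_bound) (auto simp: norm_mult)
  have "complex_of_real (exp (- t\<^sup>2 / 2)) = (\<integral>x. iexp (t * x) \<partial>std_normal_distribution)"
    using char_std_normal_distribution by (metis char_def)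
  also have "\<dots> = (\<integral>x. std_normal_density x *\<^sub>R iexp (t * x) \<partial>lborel)"
    by (rule integral_density) auto
  finally have std: "complex_of_real (exp (- t\<^sup>2 / 2)) = (\<integral>x. std_normal_density x *\<^sub>R iexp (t * x) \<partial>lborel)" .
  have "(\<integral>x. iexp (t * x) * complex_of_real (normal_density a 1 x) \<partial>lborel)
      = (\<integral>x. iexp (t * (a + x)) * complex_of_real (normal_density a 1 (a + x)) \<partial>lborel)"
    by (subst lborel_integral_real_affine[of 1 _ a]) auto
  also have "\<dots> = (\<integral>x. iexp (t * a) * (std_normal_density x *\<^sub>R iexp (t * x)) \<partial>lborel)"
    by (simp add: normal_density_def scaleR_conv_of_real ring_distribs exp_add mult_ac)
  also have "\<dots> = iexp (t * a) * complex_of_real (exp (- t\<^sup>2 / 2))"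
    by (simp only: integral_mult_right_zero std)
  finally show "(\<integral>x. iexp (t * x) * complex_of_real (normal_density a 1 x) \<partial>lborel)
      = iexp (t * a) * complex_of_real (exp (- t\<^sup>2 / 2))" .
qed

lemma Re_iexp_mult: "Re (iexp y * complex_of_real r) = cos y * r"
  by (simp add: Re_exp)

text \<open>The cosine of a sum does not factor over the coordinates, but the complex exponential
  does. So the integral is the real part of a product of one-dimensional characteristic functions,
  with the phase \<open>b\<close> as a constant factor. Each cosine wave is thus an eigenfunction of
  Gaussian smoothing with a positive eigenvalue.\<close>

lemma gauss_integral_cos:
  "(\<integral>x. cos ((\<Sum>j<d. t j * x j) + b) * gauss d x a \<partial>(\<Pi>\<^sub>M j\<in>{..<d}. lborel))
   = exp (- (\<Sum>j<d. (t j)\<^sup>2) / 2) * cos ((\<Sum>j<d. t j * a j) + b)"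
proof -
  let ?M = "\<Pi>\<^sub>M j\<in>{..<d}. (lborel :: real measure)"
  let ?F = "\<lambda>x. iexp b * (\<Prod>j<d. iexp (t j * x j) * complex_of_real (normal_density (a j) 1 (x j)))"
  have F: "?F x = iexp ((\<Sum>j<d. t j * x j) + b) * complex_of_real (gauss d x a)" for x
    by (simp add: gauss_eq_prod prod.distrib exp_sum[symmetric] ring_distribs exp_add sum_distrib_left)
  have "integrable ?M ?F"
    by (intro integrable_mult_right lborel_prod.product_integrable_prod normal_density_iexp) auto
  then have "(\<integral>x. Re (?F x) \<partial>?M) = Re (\<integral>x. ?F x \<partial>?M)"
    by (rule integral_Re)
  also have "(\<integral>x. ?F x \<partial>?M)
      = iexp b * (\<Prod>j<d. iexp (t j * a j) * complex_of_real (exp (- (t j)\<^sup>2 / 2)))"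
    by (subst integral_mult_right_zero, subst lborel_prod.product_integral_prod[OF _ normal_density_iexp(1)])
       (simp_all only: normal_density_iexp(2) finite_lessThan)
  also have "\<dots> = iexp ((\<Sum>j<d. t j * a j) + b) * complex_of_real (exp (- (\<Sum>j<d. (t j)\<^sup>2) / 2))"
    by (simp add: prod.distrib exp_sum[symmetric] ring_distribs exp_add sum_distrib_left
        sum_negf sum_divide_distrib[symmetric] flip: of_real_prod)
  finally show ?thesis
    unfolding F by (simp only: Re_iexp_mult mult.commute[of "cos _"])
qed

text \<open>Completing the square: the quadratic parts of the exponents combine with coefficient 1 +
  1 - 1 = 1, so the result is again a multiple of a Gaussian with unit covariance and is
  integrable.\<close>

lemma gauss_mult_divide:
  "gauss d x a * gauss d x b / gauss d x c
   = exp ((\<Sum>j<d. (c j)\<^sup>2 + (a j + b j - c j)\<^sup>2 - (a j)\<^sup>2 - (b j)\<^sup>2) / 2)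
     * gauss d x (\<lambda>j. a j + b j - c j)"
proof -
  have "(\<Sum>j<d. (c j)\<^sup>2 + (a j + b j - c j)\<^sup>2 - (a j)\<^sup>2 - (b j)\<^sup>2)
      = (\<Sum>j<d. (x j - (a j + b j - c j))\<^sup>2) + (\<Sum>j<d. (x j - c j)\<^sup>2)
        - (\<Sum>j<d. (x j - a j)\<^sup>2) - (\<Sum>j<d. (x j - b j)\<^sup>2)"
    unfolding sum.distrib[symmetric] sum_subtractf[symmetric]
    by (rule sum.cong) (auto simp: power2_eq_square algebra_simps)
  then show ?thesis
    by (simp add: gauss_def eucl_dist_sq divide_simps mult_ac flip: exp_add)
qed

lemma gauss_mult_divide_integrable:
  "integrable (\<Pi>\<^sub>M j\<in>{..<d}. lborel) (\<lambda>x. gauss d x a * gauss d x b / gauss d x c)"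
  unfolding gauss_mult_divide by (intro integrable_mult_right gauss_integrable)

section \<open>A lower bound for relative entropy by bounded test functions\<close>

lemma exp_le_quadratic: "exp h \<le> 1 + h + h\<^sup>2" if "\<bar>h\<bar> \<le> 1" for h :: real
proof (cases "0 \<le> h")
  case True
  then show ?thesis using exp_bound[of h] that by simp
next
  case False
  define y where "y = - h"
  have y: "0 \<le> y" "y \<le> 1" using False that by (auto simp: y_def)
  \<comment> \<open>The product equals 1 + y^3. Together with 1 + y <= exp y it bounds the
    reciprocal of exp y.\<close>
  have "1 \<le> (1 + y) * (1 - y + y\<^sup>2)"
    using y by (simp add: algebra_simps power2_eq_square)
  also have "\<dots> \<le> exp y * (1 - y + y\<^sup>2)"
    using y exp_ge_add_one_self[of y] by (intro mult_right_mono) auto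
  finally have "exp (- y) \<le> 1 - y + y\<^sup>2"
    by (simp add: exp_minus divide_simps mult.commute)
  then show ?thesis by (simp add: y_def)
qed

lemma integrable_mult_bounded:
  fixes \<psi> p :: "'a \<Rightarrow> real"
  assumes "\<psi> \<in> borel_measurable M" "\<And>x. \<bar>\<psi> x\<bar> \<le> B" "integrable M p"
  shows "integrable M (\<lambda>x. \<psi> x * p x)"
proof (rule Bochner_Integration.integrable_bound)
  show "integrable M (\<lambda>x. B * p x)" using assms(3) by simp
  show "(\<lambda>x. \<psi> x * p x) \<in> borel_measurable M" using assms(1,3) by auto
  have "\<bar>\<psi> x\<bar> * \<bar>p x\<bar> \<le> \<bar>B\<bar> * \<bar>p x\<bar>" for x
    using assms(2)[of x] by (intro mult_right_mono) auto
  then show "AE x in M. norm (\<psi> x * p x) \<le> norm (B * p x)"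
    by (simp add: abs_mult)
qed

text \<open>A Pinsker-type inequality. A tilt of size \<epsilon> along \<open>\<psi>\<close> gains
  \<epsilon> \<Delta> to first order, where \<Delta> is the difference of the two means of
  \<open>\<psi>\<close>, and costs at most \<epsilon>^2 B^2 to second order; optimising over
  \<epsilon> gives the bound.\<close>

lemma integral_log_ratio_ge:
  fixes p q \<psi> :: "'a \<Rightarrow> real"
  assumes [measurable]: "\<psi> \<in> borel_measurable M"
    and p: "integrable M p" "(\<integral>x. p x \<partial>M) = 1" "\<And>x. 0 < p x"
    and q: "integrable M q" "(\<integral>x. q x \<partial>M) = 1" "\<And>x. 0 < q x"
    and pq: "integrable M (\<lambda>x. p x * ln (p x / q x))"
    and B: "0 < B" "\<And>x. \<bar>\<psi> x\<bar> \<le> B"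
  shows "((\<integral>x. \<psi> x * q x \<partial>M) - (\<integral>x. \<psi> x * p x \<partial>M))\<^sup>2 / (4 * B\<^sup>2)
         \<le> (\<integral>x. p x * ln (p x / q x) \<partial>M)"
proof -
  note int\<psi> = integrable_mult_bounded[OF assms(1) B(2)]
  define \<Delta> where "\<Delta> = (\<integral>x. \<psi> x * q x \<partial>M) - (\<integral>x. \<psi> x * p x \<partial>M)"
  have bound: "\<bar>\<integral>x. \<psi> x * r x \<partial>M\<bar> \<le> B"
    if "integrable M r" "(\<integral>x. r x \<partial>M) = 1" "\<And>x. 0 < r x" for r
  proof -
    have "\<bar>\<integral>x. \<psi> x * r x \<partial>M\<bar> \<le> (\<integral>x. \<bar>\<psi> x * r x\<bar> \<partial>M)" by simp
    also have "\<dots> \<le> (\<integral>x. B * r x \<partial>M)"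
      using that(1,3) B(2) integrable_abs[OF int\<psi>[OF that(1)]]
      by (intro integral_mono) (simp_all add: abs_mult mult_right_mono less_imp_le)
    finally show ?thesis using that by simp
  qed
  have "\<bar>\<Delta>\<bar> \<le> 2 * B" using bound[OF p] bound[OF q] by (simp add: \<Delta>_def)
  \<comment> \<open>The maximiser of \<epsilon> \<Delta> - \<epsilon>^2 B^2. Since |\<Delta>| <= 2
    B, the tilt \<epsilon> \<psi> stays in [-1, 1], where \<open>exp_le_quadratic\<close>
    applies.\<close>
  define \<epsilon> where "\<epsilon> = \<Delta> / (2 * B\<^sup>2)"
  have \<epsilon>: "\<bar>\<epsilon> * \<psi> x\<bar> \<le> 1" for x
  proof -
    have "\<bar>\<epsilon> * \<psi> x\<bar> \<le> \<bar>\<epsilon>\<bar> * B" using B(2) by (simp add: abs_mult mult_left_mono)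
    also have "\<dots> = \<bar>\<Delta>\<bar> / (2 * B)" using B(1) by (simp add: \<epsilon>_def abs_mult power2_eq_square)
    also have "\<dots> \<le> 1" using \<open>\<bar>\<Delta>\<bar> \<le> 2 * B\<close> B(1) by simp
    finally show ?thesis .
  qed
  \<comment> \<open>Fenchel--Young for relative entropy, tested with \<open>h = - \<epsilon> \<psi>\<close>.\<close>
  have pointwise: "p x - q x + \<epsilon> * (\<psi> x * q x) - \<epsilon> * (\<psi> x * p x) - \<epsilon>\<^sup>2 * B\<^sup>2 * q x \<le> p x * ln (p x / q x)" for x
  proof -
    define h where "h = - (\<epsilon> * \<psi> x)"
    have "ln (q x * exp h / p x) \<le> q x * exp h / p x - 1"
      using p(3) q(3) by (intro ln_le_minus_one) simp
    moreover have "ln (q x * exp h / p x) = h - ln (p x / q x)"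
      using p(3)[of x] q(3)[of x] by (simp add: ln_div ln_mult)
    ultimately have "p x * (h - ln (p x / q x)) \<le> p x * (q x * exp h / p x - 1)"
      using p(3)[of x] by (intro mult_left_mono) auto
    then have "p x + p x * h - q x * exp h \<le> p x * ln (p x / q x)"
      using p(3)[of x] by (simp add: algebra_simps)
    moreover have "q x * exp h \<le> q x * (1 + h + \<epsilon>\<^sup>2 * B\<^sup>2)"
    proof -
      have "h\<^sup>2 \<le> \<epsilon>\<^sup>2 * B\<^sup>2"
        using B by (simp add: h_def power_mult_distrib abs_le_square_iff[symmetric] mult_left_mono)
      then show ?thesis
        using exp_le_quadratic[of h] \<epsilon>[of x] q(3)[of x] by (intro mult_left_mono) (auto simp: h_def)
    qed
    ultimately show ?thesis by (simp add: h_def algebra_simps)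
  qed
  have "\<Delta>\<^sup>2 / (4 * B\<^sup>2) = \<epsilon> * \<Delta> - \<epsilon>\<^sup>2 * B\<^sup>2"
    using B(1) by (simp add: \<epsilon>_def field_simps power2_eq_square)
  also have "\<dots> = (\<integral>x. p x - q x + \<epsilon> * (\<psi> x * q x) - \<epsilon> * (\<psi> x * p x) - \<epsilon>\<^sup>2 * B\<^sup>2 * q x \<partial>M)"
    using p(1,2) q(1,2) int\<psi>[OF p(1)] int\<psi>[OF q(1)] by (simp add: \<Delta>_def algebra_simps)
  also have "\<dots> \<le> (\<integral>x. p x * ln (p x / q x) \<partial>M)"
    using p(1) q(1) int\<psi>[OF p(1)] int\<psi>[OF q(1)] pq pointwise
    by (intro integral_mono) auto
  finally show ?thesis unfolding \<Delta>_def .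
qed

section \<open>Trigonometric polynomials and their preimages under Gaussian smoothing\<close>

text \<open>The real span of cosine waves with arbitrary real frequencies. The phase
  \<open>b\<close> makes sines available too, and frequency zero gives the constants. Rule induction
  reduces a linear claim to a single wave.\<close>

inductive_set trig_poly :: "nat \<Rightarrow> ((nat \<Rightarrow> real) \<Rightarrow> real) set" for d where
  trig_cos: "(\<lambda>x. cos ((\<Sum>j<d. t j * x j) + b)) \<in> trig_poly d"
| trig_add: "f \<in> trig_poly d \<Longrightarrow> g \<in> trig_poly d \<Longrightarrow> (\<lambda>x. f x + g x) \<in> trig_poly d"
| trig_scale: "f \<in> trig_poly d \<Longrightarrow> (\<lambda>x. r * f x) \<in> trig_poly d"

lemma trig_const: "(\<lambda>x. r) \<in> trig_poly d"
  using trig_scale[OF trig_cos[of "\<lambda>_. 0" d 0], of r] by simp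

lemma trig_sum: "(\<And>i. i \<in> I \<Longrightarrow> f i \<in> trig_poly d) \<Longrightarrow> (\<lambda>x. \<Sum>i\<in>I. f i x) \<in> trig_poly d"
  by (induction I rule: infinite_finite_induct) (auto intro: trig_const trig_add)

text \<open>For two waves this is the product-to-sum formula; two nested inductions extend it by
  bilinearity. Products are needed to combine zeros at several centres.\<close>

lemma trig_mult:
  assumes "f \<in> trig_poly d" "g \<in> trig_poly d"
  shows "(\<lambda>x. f x * g x) \<in> trig_poly d"
  using assms
proof (induction f)
  case (trig_cos t b)
  from trig_cos show ?case
  proof (induction g)
    case (trig_cos s c)
    have "(\<lambda>x. cos ((\<Sum>j<d. t j * x j) + b) * cos ((\<Sum>j<d. s j * x j) + c))
        = (\<lambda>x. 1 / 2 * cos ((\<Sum>j<d. (t j - s j) * x j) + (b - c))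
             + 1 / 2 * cos ((\<Sum>j<d. (t j + s j) * x j) + (b + c)))"
      by (simp add: cos_times_cos sum.distrib sum_subtractf algebra_simps add_divide_distrib)
    then show ?case by (simp only:) (intro trig_poly.intros)
  next
    case (trig_add f g)
    then show ?case using trig_poly.trig_add by (fastforce simp: distrib_left)
  next
    case (trig_scale f r)
    then show ?case using trig_poly.trig_scale[of _ d r] by (simp add: mult.left_commute)
  qed
next
  case (trig_add f g)
  then show ?case using trig_poly.trig_add by (fastforce simp: distrib_right)
next
  case (trig_scale f r)
  then show ?case using trig_poly.trig_scale[of _ d r] by (simp add: mult.assoc)
qed

lemma trig_prod: "(\<And>i. i \<in> I \<Longrightarrow> f i \<in> trig_poly d) \<Longrightarrow> (\<lambda>x. \<Prod>i\<in>I. f i x) \<in> trig_poly d"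
  by (induction I rule: infinite_finite_induct) (auto intro: trig_const trig_mult)

lemma trig_one_minus_cos:
  assumes "j < d"
  shows "(\<lambda>x. 1 - cos (\<tau> * (x j - a))) \<in> trig_poly d"
proof -
  have "(\<Sum>i<d. (if i = j then \<tau> else 0) * x i) = \<tau> * x j" for x :: "nat \<Rightarrow> real"
    using assms by (simp add: if_distrib[of "\<lambda>c. c * _"] cong: if_cong)
  then have "\<tau> * (x j - a) = (\<Sum>i<d. (if i = j then \<tau> else 0) * x i) + (- \<tau> * a)" for x :: "nat \<Rightarrow> real"
    by (simp add: right_diff_distrib)
  then have "(\<lambda>x. cos (\<tau> * (x j - a))) \<in> trig_poly d"
    using trig_cos[of "\<lambda>i. if i = j then \<tau> else 0" d "- \<tau> * a"] by (simp only:)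
  from trig_add[OF trig_const[of 1] trig_scale[OF this, of "-1"]] show ?thesis by simp
qed

text \<open>Says that \<open>g\<close> is the convolution of \<open>\<psi>\<close> with the standard
  Gaussian. The bound \<open>B\<close> is kept as explicit data, strictly positive, because the
  growth constant has its square in the denominator.\<close>

definition bounded_gauss_preimage ::
    "nat \<Rightarrow> ((nat \<Rightarrow> real) \<Rightarrow> real) \<Rightarrow> ((nat \<Rightarrow> real) \<Rightarrow> real) \<Rightarrow> real \<Rightarrow> bool" where
  "bounded_gauss_preimage d g \<psi> B \<longleftrightarrow>
     \<psi> \<in> borel_measurable (\<Pi>\<^sub>M j\<in>{..<d}. lborel) \<and> 0 < B \<and> (\<forall>x. \<bar>\<psi> x\<bar> \<le> B) \<and>
     (\<forall>a. (\<integral>x. \<psi> x * gauss d x a \<partial>(\<Pi>\<^sub>M j\<in>{..<d}. lborel)) = g a)"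

lemma bounded_gauss_preimage_integrable:
  assumes "bounded_gauss_preimage d g \<psi> B"
  shows "integrable (\<Pi>\<^sub>M j\<in>{..<d}. lborel) (\<lambda>x. \<psi> x * gauss d x a)"
  using assms unfolding bounded_gauss_preimage_def
  by (intro integrable_mult_bounded[of _ _ B] gauss_integrable) auto

text \<open>The heat semigroup multiplies each frequency by a positive factor, so it is invertible on
  trigonometric polynomials.\<close>

lemma trig_poly_gauss_preimage:
  assumes "g \<in> trig_poly d"
  shows "\<exists>\<psi> B. bounded_gauss_preimage d g \<psi> B"
  using assms
proof induction
  case (trig_cos t b)
  let ?c = "exp ((\<Sum>j<d. (t j)\<^sup>2) / 2)"
  let ?\<psi> = "\<lambda>x. ?c * cos ((\<Sum>j<d. t j * x j) + b)"
  have m: "?\<psi> \<in> borel_measurable (\<Pi>\<^sub>M j\<in>{..<d}. lborel)" by measurable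
  have bnd: "\<bar>?\<psi> x\<bar> \<le> ?c" for x by (simp add: abs_mult)
  have eq: "(\<integral>x. ?\<psi> x * gauss d x a \<partial>(\<Pi>\<^sub>M j\<in>{..<d}. lborel)) = cos ((\<Sum>j<d. t j * a j) + b)" for a
  proof -
    have "(\<integral>x. ?\<psi> x * gauss d x a \<partial>(\<Pi>\<^sub>M j\<in>{..<d}. lborel))
        = ?c * (\<integral>x. cos ((\<Sum>j<d. t j * x j) + b) * gauss d x a \<partial>(\<Pi>\<^sub>M j\<in>{..<d}. lborel))"
      by (simp only: mult.assoc integral_mult_right_zero)
    then show ?thesis by (simp add: gauss_integral_cos exp_minus)
  qed
  have "bounded_gauss_preimage d (\<lambda>x. cos ((\<Sum>j<d. t j * x j) + b)) ?\<psi> ?c"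
    unfolding bounded_gauss_preimage_def using m bnd eq exp_gt_zero by blast
  then show ?case by blast
next
  case (trig_add f g)
  then obtain \<psi> B \<phi> C where f: "bounded_gauss_preimage d f \<psi> B" and g: "bounded_gauss_preimage d g \<phi> C"
    by blast
  have "\<bar>\<psi> x\<bar> \<le> B" "\<bar>\<phi> x\<bar> \<le> C" for x
    using f g by (auto simp: bounded_gauss_preimage_def)
  then have "\<bar>\<psi> x + \<phi> x\<bar> \<le> B + C" for x
    by (meson abs_triangle_ineq add_mono order_trans)
  then have "bounded_gauss_preimage d (\<lambda>x. f x + g x) (\<lambda>x. \<psi> x + \<phi> x) (B + C)"
    using f g bounded_gauss_preimage_integrable[OF f] bounded_gauss_preimage_integrable[OF g]
    by (auto simp: bounded_gauss_preimage_def distrib_right)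
  then show ?case by blast
next
  case (trig_scale f r)
  then obtain \<psi> B where f: "bounded_gauss_preimage d f \<psi> B" by blast
  have "\<bar>r\<bar> * \<bar>\<psi> x\<bar> \<le> \<bar>r\<bar> * B" for x
    using f by (intro mult_left_mono) (auto simp: bounded_gauss_preimage_def)
  \<comment> \<open>The summand 1 keeps the bound strictly positive when \<open>r\<close> is
    0.\<close>
  then have "\<bar>r * \<psi> x\<bar> \<le> \<bar>r\<bar> * B + 1" for x
    unfolding abs_mult by (meson add_increasing2 zero_le_one)
  then have "bounded_gauss_preimage d (\<lambda>x. r * f x) (\<lambda>x. r * \<psi> x) (\<bar>r\<bar> * B + 1)"
    using f by (auto simp: bounded_gauss_preimage_def mult.assoc add_nonneg_pos)
  then show ?case by blast
qed

section \<open>A trigonometric polynomial with prescribed nondegenerate zeros\<close>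

text \<open>With z = |y| / 2, the half-angle formula gives 1 - cos y = 2 (sin z)^2. On [0, 1/2] the
  Taylor remainder z^3 / 6 is at most z / 6, so sin z >= 5 z / 6, and 2 (5/6)^2 >= 1.\<close>

lemma one_minus_cos_ge: "y\<^sup>2 / 4 \<le> 1 - cos y" if "\<bar>y\<bar> \<le> 1" for y :: real
proof -
  define z where "z = \<bar>y / 2\<bar>"
  have z: "0 \<le> z" "z \<le> 1 / 2" using that by (auto simp: z_def)
  have "\<bar>sin z - z\<bar> \<le> z ^ 3 / 6"
    using Maclaurin_sin_bound[of z 3] z by (simp add: numeral_3_eq_3 sin_coeff_def fact_numeral)
  moreover have "z ^ 3 \<le> z * 1"
    using z mult_le_one[of z z] mult_left_mono[of "z * z" 1 z] by (simp add: power3_eq_cube mult.assoc)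
  ultimately have "5 / 6 * z \<le> sin z" by linarith
  then have "(5 / 6 * z)\<^sup>2 \<le> (sin z)\<^sup>2" using z by (intro power_mono) auto
  then have "25 * z\<^sup>2 \<le> 36 * (sin z)\<^sup>2" by (simp add: power_mult_distrib power_divide)
  moreover have "cos y = 1 - 2 * (sin z)\<^sup>2"
    using cos_double_sin[of z] cos_abs_real[of y] by (simp add: z_def)
  moreover have "y\<^sup>2 = 4 * z\<^sup>2" by (simp add: z_def power_divide)
  moreover have "0 \<le> z\<^sup>2" by simp
  ultimately show ?thesis by linarith
qed

text \<open>Give each point of \<open>P\<close> a sum of terms 1 - cos, one per coordinate, which
  vanishes there to exactly second order, and multiply these sums. Near one point the other factors
  stay away from zero, provided the frequency is so low that their periodic zeros lie out of
  reach.\<close>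

lemma trig_poly_vanishing_quadratically:
  assumes "finite P" "P \<subseteq> extensional {..<d}"
  obtains g \<delta> c where "g \<in> trig_poly d" "0 < \<delta>" "0 < c"
    "\<forall>a\<in>P. \<forall>x. (\<forall>j<d. x j = a j) \<longrightarrow> g x = 0"
    "\<forall>a\<in>P. \<forall>x. (\<forall>j<d. \<bar>x j - a j\<bar> < \<delta>) \<longrightarrow> c * (\<Sum>j<d. (x j - a j)\<^sup>2) \<le> g x"
proof -
  \<comment> \<open>Extensional functions agree outside \<open>{..<d}\<close>, so distinct ones
    differ at an index below \<open>d\<close>; \<open>J\<close> selects such an index.\<close>
  have "\<exists>j<d. a j \<noteq> b j" if "a \<in> P" "b \<in> P" "a \<noteq> b" for a b
    using that assms(2) by (meson extensionalityI lessThan_iff subsetD)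
  then obtain J where J: "\<And>a b. a \<in> P \<Longrightarrow> b \<in> P \<Longrightarrow> a \<noteq> b \<Longrightarrow> J a b < d \<and> a (J a b) \<noteq> b (J a b)"
    by metis
  \<comment> \<open>A positive \<rho> below all the coordinate gaps. The filter
    \<open>at_right 0\<close> replaces a minimum, which would have to be taken over an empty set if
    \<open>P\<close> has at most one point.\<close>
  have "eventually (\<lambda>\<rho>. \<forall>z\<in>P \<times> P. case z of (a, b) \<Rightarrow> a \<noteq> b \<longrightarrow> \<rho> < \<bar>a (J a b) - b (J a b)\<bar>)
      (at_right 0)"
  proof (intro eventually_ball_finite ballI)
    fix z assume "z \<in> P \<times> P"
    then obtain a b where z: "z = (a, b)" "a \<in> P" "b \<in> P" by auto
    show "eventually (\<lambda>\<rho>. case z of (a, b) \<Rightarrow> a \<noteq> b \<longrightarrow> \<rho> < \<bar>a (J a b) - b (J a b)\<bar>) (at_right 0)"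
    proof (cases "a = b")
      case False
      then have "0 < \<bar>a (J a b) - b (J a b)\<bar>" using J[of a b] z by simp
      then show ?thesis unfolding z(1) eventually_at_right_field
        by (intro exI[of _ "\<bar>a (J a b) - b (J a b)\<bar>"]) simp
    qed (simp add: z(1))
  qed (use assms(1) in simp)
  then obtain \<rho> where \<rho>: "0 < \<rho>"
    "\<And>a b. a \<in> P \<Longrightarrow> b \<in> P \<Longrightarrow> a \<noteq> b \<Longrightarrow> \<rho> < \<bar>a (J a b) - b (J a b)\<bar>"
    unfolding eventually_at_right_field by (force dest: dense)
  \<comment> \<open>\<open>R\<close> bounds |x j - b j| for all \<open>b\<close> in \<open>P\<close>
    whenever \<open>x\<close> is within \<rho>/2 of some point of \<open>P\<close>; the summand
    \<rho> also keeps it positive. With frequency 1 / \<open>R\<close> the cosine arguments stay in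
    [-1, 1], as \<open>one_minus_cos_ge\<close> requires.\<close>
  define R where "R = \<rho> + (\<Sum>(a, b)\<in>P \<times> P. \<Sum>j<d. \<bar>a j - b j\<bar>)"
  have R: "\<bar>a j - b j\<bar> + \<rho> \<le> R" if "a \<in> P" "b \<in> P" "j < d" for a b j
  proof -
    have "\<bar>a j - b j\<bar> \<le> (\<Sum>j<d. \<bar>a j - b j\<bar>)"
      using that by (intro member_le_sum) auto
    also have "\<dots> \<le> (\<Sum>(a, b)\<in>P \<times> P. \<Sum>j<d. \<bar>a j - b j\<bar>)"
      using that assms(1) member_le_sum[of "(a, b)" "P \<times> P" "\<lambda>(a, b). \<Sum>j<d. \<bar>a j - b j\<bar>"]
      by (auto simp: sum_nonneg)
    finally show ?thesis by (simp add: R_def)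
  qed
  have "\<rho> \<le> R" unfolding R_def by (auto intro!: sum_nonneg)
  define \<tau> where "\<tau> = 1 / R"
  have \<tau>: "0 < \<tau>" using \<rho>(1) \<open>\<rho> \<le> R\<close> by (simp add: \<tau>_def)
  have cos_ge: "\<tau>\<^sup>2 / 4 * y\<^sup>2 \<le> 1 - cos (\<tau> * y)" if "\<bar>y\<bar> \<le> R" for y
    using one_minus_cos_ge[of "\<tau> * y"] that \<tau>
    by (simp add: \<tau>_def abs_mult power_mult_distrib power_divide)
  define h where "h = (\<lambda>a x. \<Sum>j<d. 1 - cos (\<tau> * (x j - a j)))"
  \<comment> \<open>A lower bound for the factor of \<open>b\<close> near another point
    \<open>a\<close>: in coordinate \<open>J a b\<close> the two points are more than \<rho> apart,
    hence \<open>x\<close> is still at least \<rho>/2 from \<open>b\<close>. Each of the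
    \<open>card P - 1\<close> other factors contributes one \<open>e\<close> to the final
    constant.\<close>
  define e where "e = \<tau>\<^sup>2 / 4 * (\<rho> / 2)\<^sup>2"
  have "0 < e" using \<tau> \<rho>(1) by (simp add: e_def)
  show ?thesis
  proof
    show "(\<lambda>x. \<Prod>a\<in>P. h a x) \<in> trig_poly d"
      unfolding h_def by (intro trig_prod trig_sum trig_one_minus_cos) auto
    show "0 < \<rho> / 2" "0 < \<tau>\<^sup>2 / 4 * e ^ (card P - 1)"
      using \<rho>(1) \<tau> \<open>0 < e\<close> by auto
    show "\<forall>a\<in>P. \<forall>x. (\<forall>j<d. x j = a j) \<longrightarrow> (\<Prod>a\<in>P. h a x) = 0"
    proof (intro ballI allI impI)
      fix a x assume "a \<in> P" "\<forall>j<d. x j = a j"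
      moreover from this have "h a x = 0" by (simp add: h_def)
      ultimately show "(\<Prod>a\<in>P. h a x) = 0" using assms(1) by (auto simp: prod_zero_iff)
    qed
    show "\<forall>a\<in>P. \<forall>x. (\<forall>j<d. \<bar>x j - a j\<bar> < \<rho> / 2) \<longrightarrow>
      \<tau>\<^sup>2 / 4 * e ^ (card P - 1) * (\<Sum>j<d. (x j - a j)\<^sup>2) \<le> (\<Prod>a\<in>P. h a x)"
    proof (intro ballI allI impI)
      fix a x assume a: "a \<in> P" and "\<forall>j<d. \<bar>x j - a j\<bar> < \<rho> / 2"
      then have x: "\<And>j. j < d \<Longrightarrow> \<bar>x j - a j\<bar> < \<rho> / 2" by blast
      have "e \<le> h b x" if b: "b \<in> P - {a}" for b
      proof -
        let ?j = "J a b"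
        have j: "?j < d" "\<rho> < \<bar>a ?j - b ?j\<bar>" using J[of a b] \<rho>(2)[of a b] a b by auto
        have "\<bar>x ?j - b ?j\<bar> \<le> R" "\<rho> / 2 \<le> \<bar>x ?j - b ?j\<bar>"
          using x[OF j(1)] R[OF a _ j(1), of b] b j(2) by (simp_all add: abs_if split: if_splits)
        then have "e \<le> \<tau>\<^sup>2 / 4 * (x ?j - b ?j)\<^sup>2"
          using \<rho>(1) unfolding e_def by (intro mult_left_mono) (auto simp: abs_le_square_iff[symmetric])
        also have "\<dots> \<le> 1 - cos (\<tau> * (x ?j - b ?j))"
          by (rule cos_ge) fact
        also have "\<dots> \<le> h b x"
          unfolding h_def using j(1) by (intro member_le_sum[where f = "\<lambda>j. 1 - cos (\<tau> * (x j - b j))"]) auto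
        finally show ?thesis .
      qed
      then have "e ^ (card P - 1) \<le> (\<Prod>b\<in>P - {a}. h b x)"
        using prod_mono[of "P - {a}" "\<lambda>_. e" "\<lambda>b. h b x"] \<open>0 < e\<close> a assms(1) by simp
      moreover have "\<tau>\<^sup>2 / 4 * (\<Sum>j<d. (x j - a j)\<^sup>2) \<le> h a x"
        unfolding h_def sum_distrib_left
        using x \<open>\<rho> \<le> R\<close> by (intro sum_mono cos_ge) (smt (verit) lessThan_iff field_sum_of_halves \<rho>(1))
      ultimately have "\<tau>\<^sup>2 / 4 * (\<Sum>j<d. (x j - a j)\<^sup>2) * e ^ (card P - 1) \<le> h a x * (\<Prod>b\<in>P - {a}. h b x)"
        using \<open>0 < e\<close>
        by (intro mult_mono) (auto intro: sum_nonneg simp: h_def)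
      then show "\<tau>\<^sup>2 / 4 * e ^ (card P - 1) * (\<Sum>j<d. (x j - a j)\<^sup>2) \<le> (\<Prod>a\<in>P. h a x)"
        using a assms(1) by (simp add: prod.remove mult_ac)
    qed
  qed
qed

section \<open>Mixtures, integrability of the log ratio, and the loss\<close>

lemma mixture_pos:
  assumes "0 < k" "\<And>i. i < k \<Longrightarrow> 0 < w i"
  shows "0 < mixture d k \<mu> w x"
  unfolding mixture_def using assms by (intro sum_pos) (auto simp: gauss_pos)

lemma mixture_measurable [measurable]:
  "mixture d k \<mu> w \<in> borel_measurable (\<Pi>\<^sub>M j\<in>{..<d}. lborel)"
  unfolding mixture_def[abs_def] by measurable

lemma mixture_integrable: "integrable (\<Pi>\<^sub>M j\<in>{..<d}. lborel) (mixture d k \<mu> w)"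
  unfolding mixture_def[abs_def]
  by (intro Bochner_Integration.integrable_sum integrable_mult_right gauss_integrable)

lemma mixture_integral:
  "(\<integral>x. mixture d k \<mu> w x \<partial>(\<Pi>\<^sub>M j\<in>{..<d}. lborel)) = (\<Sum>i<k. w i)"
  unfolding mixture_def by (simp add: gauss_integrable gauss_integral)

text \<open>The Bochner integral of a non-integrable function is 0 by default, so monotonicity in
  \<open>integral_log_ratio_ge\<close> needs this fact. As |ln r| <= r + 1/r, the integrand is
  dominated by p^2/q + q.\<close>

lemma log_ratio_integrable:
  assumes "0 < n" "\<And>i. i < n \<Longrightarrow> 0 < \<pi> i" "\<And>x. 0 < mixture d k \<nu> w x"
  shows "integrable (\<Pi>\<^sub>M j\<in>{..<d}. lborel)
    (\<lambda>x. mixture d k \<nu> w x * ln (mixture d k \<nu> w x / mixture d n \<mu> \<pi> x))"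
    (is "integrable ?M (\<lambda>x. ?p x * ln (?p x / ?q x))")
proof -
  have q: "0 < ?q x" for x using assms(1,2) by (rule mixture_pos)
  \<comment> \<open>One Gaussian of the denominator suffices: \<open>\<phi>(x|a) \<phi>(x|b) / \<phi>(x|c)\<close> is a multiple of
    \<open>\<phi>(x|a + b - c)\<close>.\<close>
  let ?b = "\<lambda>x. (\<Sum>i<k. \<Sum>l<k. w i * w l * (gauss d x (\<nu> i) * gauss d x (\<nu> l) / gauss d x (\<mu> 0))) / \<pi> 0 + ?q x"
  have "integrable ?M ?b"
    by (intro Bochner_Integration.integrable_add integrable_divide Bochner_Integration.integrable_sum
        integrable_mult_right gauss_mult_divide_integrable mixture_integrable)
  then show ?thesis
  proof (rule Bochner_Integration.integrable_bound)
    show "AE x in ?M. norm (?p x * ln (?p x / ?q x)) \<le> norm (?b x)"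
    proof (rule AE_I2)
      fix x
      have p: "0 < ?p x" by (rule assms(3))
      have "ln (?p x / ?q x) \<le> ?p x / ?q x - 1" "ln (?q x / ?p x) \<le> ?q x / ?p x - 1"
        using p q[of x] by (auto intro: ln_le_minus_one)
      moreover have "ln (?q x / ?p x) = - ln (?p x / ?q x)"
        using p q[of x] by (simp add: ln_div)
      moreover have "0 < ?p x / ?q x" "0 < ?q x / ?p x" using p q[of x] by auto
      ultimately have "\<bar>ln (?p x / ?q x)\<bar> \<le> ?p x / ?q x + ?q x / ?p x" by linarith
      then have "\<bar>?p x * ln (?p x / ?q x)\<bar> \<le> ?p x * (?p x / ?q x + ?q x / ?p x)"
        using p by (simp add: abs_mult)
      also have "\<dots> = ?p x * ?p x / ?q x + ?q x"
        using p by (simp add: distrib_left)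
      also have "?p x * ?p x / ?q x \<le> ?p x * ?p x / (\<pi> 0 * gauss d x (\<mu> 0))"
      proof (rule divide_left_mono)
        show "\<pi> 0 * gauss d x (\<mu> 0) \<le> ?q x"
          unfolding mixture_def using assms(1,2)
          by (intro member_le_sum[where f = "\<lambda>i. \<pi> i * gauss d x (\<mu> i)"])
             (auto simp: gauss_pos less_imp_le)
        show "0 < ?q x * (\<pi> 0 * gauss d x (\<mu> 0))" "0 \<le> ?p x * ?p x"
          using q assms(1,2) by (auto simp: gauss_pos)
      qed
      also have "?p x * ?p x / (\<pi> 0 * gauss d x (\<mu> 0))
          = (\<Sum>i<k. \<Sum>l<k. w i * w l * (gauss d x (\<nu> i) * gauss d x (\<nu> l) / gauss d x (\<mu> 0))) / \<pi> 0"
        by (simp add: mixture_def sum_product sum_divide_distrib mult_ac)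
      finally show "norm (?p x * ln (?p x / ?q x)) \<le> norm (?b x)"
        by (smt (verit) real_norm_def)
    qed
  qed measurable
qed

lemma pop_loss_eq:
  assumes "\<And>x. 0 < mixture d m \<mu>s \<pi>s x"
  shows "pop_loss d m \<mu>s \<pi>s n \<mu> \<pi> = (\<integral>x. mixture d m \<mu>s \<pi>s x *
    ln (mixture d m \<mu>s \<pi>s x / mixture d n \<mu> \<pi> x) \<partial>(\<Pi>\<^sub>M j\<in>{..<d}. lborel))"
  unfolding pop_loss_def mixture_measure_def
  by (subst integral_density) (auto simp: assms less_imp_le)

lemma family_dist_sq: "(family_dist n d \<mu> \<nu>)\<^sup>2 = (\<Sum>i<n. \<Sum>j<d. (\<mu> i j - \<nu> i j)\<^sup>2)"
  by (simp add: family_dist_def L2_set_def sum_nonneg sum.cartesian_product case_prod_beta)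

lemma abs_diff_le_family_dist:
  assumes "i < n" "j < d"
  shows "\<bar>\<mu> i j - \<nu> i j\<bar> \<le> family_dist n d \<mu> \<nu>"
  using member_le_L2_set[of "{..<n} \<times> {..<d}" "(i, j)" "\<lambda>(i, j). \<bar>\<mu> i j - \<nu> i j\<bar>"] assms
  by (simp add: family_dist_def L2_set_def case_prod_beta)

text \<open>Within a cluster all students share the first \<open>d\<close> coordinates of the
  teacher centre, so their Gaussians coincide and their weights add up. The teacher can therefore be
  rewritten as a student mixture with the same weights \<open>\<pi>\<close>.\<close>

lemma exact_clustering_mixture:
  assumes "exact_clustering d m n \<mu>s \<pi>s \<mu> \<pi> S"
  shows "mixture d m \<mu>s \<pi>s = mixture d n \<mu> \<pi>"
proof
  fix x
  have S: "disjoint_family_on S {..<m}" "(\<Union>l<m. S l) = {..<n}"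
    "\<And>l i j. l < m \<Longrightarrow> i \<in> S l \<Longrightarrow> j < d \<Longrightarrow> \<mu> i j = \<mu>s l j" "\<And>l. l < m \<Longrightarrow> (\<Sum>i\<in>S l. \<pi> i) = \<pi>s l"
    using assms by (auto simp: exact_clustering_def)
  have fin: "finite (S l)" if "l < m" for l
    using S(2) that by (metis UN_upper finite_lessThan finite_subset lessThan_iff)
  have "mixture d n \<mu> \<pi> x = (\<Sum>i\<in>(\<Union>l<m. S l). \<pi> i * gauss d x (\<mu> i))"
    by (simp add: mixture_def S(2))
  also have "\<dots> = (\<Sum>l<m. \<Sum>i\<in>S l. \<pi> i * gauss d x (\<mu> i))"
    using S(1) fin by (intro sum.UNION_disjoint) (auto simp: disjoint_family_on_def)
  also have "\<dots> = (\<Sum>l<m. \<Sum>i\<in>S l. \<pi> i * gauss d x (\<mu>s l))"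
    by (intro sum.cong refl arg_cong2[where f = "(*)"] gauss_cong S(3)) auto
  also have "\<dots> = mixture d m \<mu>s \<pi>s x"
    by (simp add: mixture_def S(4) flip: sum_distrib_right)
  finally show "mixture d m \<mu>s \<pi>s x = mixture d n \<mu> \<pi> x" ..
qed

section \<open>Quartic growth of the loss\<close>

lemma pop_loss_quartic_growth:
  assumes mix: "mixture d m \<mu>s \<pi>s = mixture d n \<mu>t \<pi>"
    and \<pi>: "\<pi> \<in> prob_simplex n" "\<And>i. i < n \<Longrightarrow> 0 < \<pi> i"
  shows "\<exists>U c. neighbourhood n d \<mu>t U \<and> 0 < c \<and>
    (\<forall>\<mu>\<in>U. c * family_dist n d \<mu> \<mu>t ^ 4 \<le> pop_loss d m \<mu>s \<pi>s n \<mu> \<pi> - pop_loss d m \<mu>s \<pi>s n \<mu>t \<pi>)"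
proof -
  let ?M = "\<Pi>\<^sub>M j\<in>{..<d}. (lborel :: real measure)"
  have sum1: "(\<Sum>i<n. \<pi> i) = 1" using \<pi>(1) by (simp add: prob_simplex_def)
  then have n: "0 < n" by (cases n) auto
  \<comment> \<open>Restriction makes the centres extensional, so students in the same place become
    a single point of \<open>P\<close> and yield a single factor.\<close>
  define P where "P = (\<lambda>i. restrict (\<mu>t i) {..<d}) ` {..<n}"
  obtain g \<delta> c where g: "g \<in> trig_poly d" "0 < \<delta>" "0 < c"
    "\<forall>a\<in>P. \<forall>x. (\<forall>j<d. x j = a j) \<longrightarrow> g x = 0"
    "\<forall>a\<in>P. \<forall>x. (\<forall>j<d. \<bar>x j - a j\<bar> < \<delta>) \<longrightarrow> c * (\<Sum>j<d. (x j - a j)\<^sup>2) \<le> g x"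
  proof (rule trig_poly_vanishing_quadratically)
    show "finite P" "P \<subseteq> extensional {..<d}" by (auto simp: P_def)
  qed (rule that)
  have g0: "g (\<mu>t i) = 0" if "i < n" for i
    using g(4) that by (simp add: P_def)
  have g_ge: "c * (\<Sum>j<d. (x j - \<mu>t i j)\<^sup>2) \<le> g x"
    if "i < n" "\<And>j. j < d \<Longrightarrow> \<bar>x j - \<mu>t i j\<bar> < \<delta>" for i x
    using g(5) that by (simp add: P_def)
  obtain \<psi> B where pre: "bounded_gauss_preimage d g \<psi> B"
    using trig_poly_gauss_preimage[OF g(1)] by blast
  then have \<psi>: "\<psi> \<in> borel_measurable ?M" "0 < B" "\<And>x. \<bar>\<psi> x\<bar> \<le> B"
    "\<And>a. (\<integral>x. \<psi> x * gauss d x a \<partial>?M) = g a"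
    by (auto simp: bounded_gauss_preimage_def)
  \<comment> \<open>With the weights fixed, testing against \<open>\<psi>\<close> turns a mixture
    into a weighted sum of values of \<open>g\<close> at its centres; at the centres
    \<open>\<mu>t\<close> this sum vanishes.\<close>
  have \<psi>_mixture: "(\<integral>x. \<psi> x * mixture d n \<nu> \<pi> x \<partial>?M) = (\<Sum>i<n. \<pi> i * g (\<nu> i))" for \<nu>
    by (simp add: mixture_def sum_distrib_left mult.left_commute \<psi>(4)
        bounded_gauss_preimage_integrable[OF pre])
  \<comment> \<open>The smallest student weight, used to pass from the weighted sum of squared
    displacements to the unweighted squared distance.\<close>
  define w where "w = Min (\<pi> ` {..<n})"
  have w: "0 < w" "\<And>i. i < n \<Longrightarrow> w \<le> \<pi> i"
    using n \<pi>(2) by (auto simp: w_def lessThan_empty_iff)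
  have pos: "0 < mixture d n \<nu> \<pi> x" for \<nu> x
    using n \<pi>(2) by (rule mixture_pos)
  have loss: "pop_loss d m \<mu>s \<pi>s n \<nu> \<pi>
      = (\<integral>x. mixture d n \<mu>t \<pi> x * ln (mixture d n \<mu>t \<pi> x / mixture d n \<nu> \<pi> x) \<partial>?M)" for \<nu>
    using pop_loss_eq[of d m \<mu>s \<pi>s n \<nu> \<pi>] pos by (simp add: mix)
  have loss0: "pop_loss d m \<mu>s \<pi>s n \<mu>t \<pi> = 0"
    using pos by (simp add: loss less_imp_neq[symmetric])
  \<comment> \<open>If the means of \<open>\<psi>\<close> differ by at least w c D^2, where D is the
    family distance, the entropy bound gives (w c D^2)^2 / (4 B^2), which is \<open>c4\<close> times
    D^4.\<close>
  define c4 where "c4 = (w * c)\<^sup>2 / (4 * B\<^sup>2)"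
  have "c4 * family_dist n d \<mu> \<mu>t ^ 4 \<le> pop_loss d m \<mu>s \<pi>s n \<mu> \<pi>"
    if near: "family_dist n d \<mu> \<mu>t < \<delta>" for \<mu>
  proof -
    have "w * c * (family_dist n d \<mu> \<mu>t)\<^sup>2 = (\<Sum>i<n. w * (c * (\<Sum>j<d. (\<mu> i j - \<mu>t i j)\<^sup>2)))"
      by (simp add: family_dist_sq sum_distrib_left mult.assoc)
    also have "\<dots> \<le> (\<Sum>i<n. \<pi> i * g (\<mu> i))"
    proof (intro sum_mono mult_mono)
      fix i assume "i \<in> {..<n}"
      then show "w \<le> \<pi> i" "0 \<le> \<pi> i" using w \<pi>(2)[of i] by auto
      \<comment> \<open>Each coordinate displacement is at most the family distance, so a ball of
        radius \<delta> puts every student in the region where the quadratic bound on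
        \<open>g\<close> holds.\<close>
      show "c * (\<Sum>j<d. (\<mu> i j - \<mu>t i j)\<^sup>2) \<le> g (\<mu> i)"
        using \<open>i \<in> {..<n}\<close> near
        by (intro g_ge) (auto intro: le_less_trans[OF abs_diff_le_family_dist])
      show "0 \<le> c * (\<Sum>j<d. (\<mu> i j - \<mu>t i j)\<^sup>2)" using g(3) by (simp add: sum_nonneg)
    qed
    also have "\<dots> = (\<integral>x. \<psi> x * mixture d n \<mu> \<pi> x \<partial>?M) - (\<integral>x. \<psi> x * mixture d n \<mu>t \<pi> x \<partial>?M)"
      by (simp add: \<psi>_mixture g0)
    finally have "(w * c * (family_dist n d \<mu> \<mu>t)\<^sup>2)\<^sup>2 / (4 * B\<^sup>2)
        \<le> ((\<integral>x. \<psi> x * mixture d n \<mu> \<pi> x \<partial>?M) - (\<integral>x. \<psi> x * mixture d n \<mu>t \<pi> x \<partial>?M))\<^sup>2 / (4 * B\<^sup>2)"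
      using w(1) g(3) by (intro divide_right_mono power_mono) auto
    also have "\<dots> \<le> pop_loss d m \<mu>s \<pi>s n \<mu> \<pi>"
      unfolding loss
      by (intro integral_log_ratio_ge \<psi>(1-3) mixture_integrable pos log_ratio_integrable n \<pi>(2))
         (simp_all add: mixture_integral sum1)
    finally show ?thesis by (simp add: c4_def power_mult_distrib flip: power_mult)
  qed
  then show ?thesis
    using g(2,3) w(1) \<psi>(2) loss0
    by (intro exI[of _ "{\<mu>. family_dist n d \<mu> \<mu>t < \<delta>}"] exI[of _ c4])
       (auto simp: neighbourhood_def c4_def)
qed

theorem theoremB6:
  shows "\<exists>C0::real. C0 > 0 \<and>
    (\<forall>(d::nat) (m::nat) (n::nat) (\<mu>s :: nat \<Rightarrow> nat \<Rightarrow> real) (\<pi>s :: nat \<Rightarrow> real)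
       (Dmin::real) (Dmax::real) (\<mu>t :: nat \<Rightarrow> nat \<Rightarrow> real) (\<pi> :: nat \<Rightarrow> real) (S :: nat \<Rightarrow> nat set).
       \<pi>s \<in> prob_simplex m \<longrightarrow> (\<forall>l<m. 0 < \<pi>s l) \<longrightarrow>
       spectral_cond d m \<mu>s \<pi>s \<longrightarrow>
       norm_cond d m n \<mu>s \<pi>s Dmin Dmax \<longrightarrow>
       separation_cond C0 d m n \<mu>s \<pi>s Dmax \<longrightarrow>
       \<pi> \<in> prob_simplex n \<longrightarrow> (\<forall>i<n. 0 < \<pi> i) \<longrightarrow>
       exact_clustering d m n \<mu>s \<pi>s \<mu>t \<pi> S \<longrightarrow>
       (\<exists>U c4. neighbourhood n d \<mu>t U \<and> c4 > 0 \<and>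
          (\<forall>\<mu>\<in>U. pop_loss d m \<mu>s \<pi>s n \<mu> \<pi> - pop_loss d m \<mu>s \<pi>s n \<mu>t \<pi>
                    \<ge> c4 * family_dist n d \<mu> \<mu>t ^ 4)))"
proof (intro exI[of _ 1] conjI allI impI)
  fix d m n :: nat and \<mu>s \<mu>t :: "nat \<Rightarrow> nat \<Rightarrow> real" and \<pi>s \<pi> :: "nat \<Rightarrow> real" and S
  assume "exact_clustering d m n \<mu>s \<pi>s \<mu>t \<pi> S" "\<pi> \<in> prob_simplex n" "\<forall>i<n. 0 < \<pi> i"
  then show "\<exists>U c4. neighbourhood n d \<mu>t U \<and> c4 > 0 \<and>
      (\<forall>\<mu>\<in>U. pop_loss d m \<mu>s \<pi>s n \<mu> \<pi> - pop_loss d m \<mu>s \<pi>s n \<mu>t \<pi>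
                \<ge> c4 * family_dist n d \<mu> \<mu>t ^ 4)"
    by (intro pop_loss_quartic_growth exact_clustering_mixture) auto
qed simp

end
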